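(* Strong Nash equilibrium does not always exist for Mechanism $GM^*$ in a general metric space: there exists an instance of the strategic facility location game (in some metric space) for which there is no strong Nash equilibrium under $GM^*$.
   Context: Setting. An instance consists of a metric space with distance $d$; a set $\mathcal{C}$ of $n$ clients, each having a true location in the metric space (several clients may share a location; the true location of client $i$ is also denoted $i$); a finite nonempty set $\mathcal{F}$ of possible facility locations in the metric space, equipped with a fixed total ordering (an element earlier in the ordering is called lower-numbered); and a partition $\mathcal{C}=T\cup L$, $T\cap L=\emptyset$, with $|L|=k\ge 1$, $|T|=n-k$ ($T$ may be empty). Clients in $T$ always report their true location; each client $i\in L$ (strategic) may report any point $x_i$ of the metric space. Let $\vec t$ be the vector of true locations of clients in $T$ and $\vec x=(x_i)_{i\in L}$ the vector of reports of the strategic clients. Perceived cost of $A\in\mathcal{F}$: $cost_A(\vec t;\vec x)=\sum_{i\in T}d(i,A)+\sum_{i\in L}d(x_i,A)$. Mechanism $GM^*$: given reports $(\vec t;\vec x)$, output the facility $GM^*(\vec t;\vec x)\in\mathcal{F}$ minimizing $cost_A(\vec t;\vec x)$ over $A\in\mathcal{F}$, ties broken in favor of the lowest-numbered facility. Strong Nash equilibrium (SNE) under a mechanism $M$: a profile $(\vec t;\vec x)$ such that for every nonempty set $I\subseteq L$ and every vector $x_I'$ of reports for the clients in $I$, there is a client $i\in I$ with $d(i,M(\vec t;\vec x_{-I},x_I'))\ge d(i,M(\vec t;\vec x))$, where $(\vec x_{-I},x_I')$ is $\vec x$ with the reports of clients in $I$ replaced by $x_I'$. *)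

theory Defs
  imports "HOL-Analysis.Analysis"
begin

text \<open>
  \<open>loc i\<close> is the true location of client \<open>i\<close>; \<open>(A, B) \<in> ord\<close> means that \<open>A\<close> equals \<open>B\<close> or is
  lower-numbered than \<open>B\<close>. Facilities are points of the metric space.
\<close>

locale facility_instance = Metric_space M d
  for M :: "'p set" and d :: "'p \<Rightarrow> 'p \<Rightarrow> real" +
  fixes C T L :: "'c set"
    and loc :: "'c \<Rightarrow> 'p"
    and F :: "'p set"
    and ord :: "('p \<times> 'p) set"
  assumes finite_clients: "finite C"
    and clients_partition: "C = T \<union> L" "T \<inter> L = {}"
    and strategic_nonempty: "L \<noteq> {}"
    and loc_in_space: "loc ` C \<subseteq> M"
    and finite_facilities: "finite F"
    and facilities_nonempty: "F \<noteq> {}"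
    and facilities_in_space: "F \<subseteq> M"
    and facility_order: "linear_order_on F ord"
begin

definition cost :: "('c \<Rightarrow> 'p) \<Rightarrow> ('c \<Rightarrow> 'p) \<Rightarrow> 'p \<Rightarrow> real" where
  "cost t x A = (\<Sum>i\<in>T. d (t i) A) + (\<Sum>i\<in>L. d (x i) A)"

definition GM_star :: "('c \<Rightarrow> 'p) \<Rightarrow> ('c \<Rightarrow> 'p) \<Rightarrow> 'p" where
  "GM_star t x = (THE A. A \<in> F \<and> (\<forall>B\<in>F. cost t x A \<le> cost t x B) \<and>
     (\<forall>B\<in>F. cost t x B = cost t x A \<longrightarrow> (A, B) \<in> ord))"

text \<open>
  A mechanism takes the vectors \<open>t\<close> and \<open>x\<close> of reports of \<open>T\<close> and \<open>L\<close>. Both vectors are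
  extensional functions, so a mechanism sees the true locations of the clients in \<open>T\<close> only.
\<close>

definition true_reports :: "'c \<Rightarrow> 'p" where
  "true_reports = restrict loc T"

definition strong_Nash :: "(('c \<Rightarrow> 'p) \<Rightarrow> ('c \<Rightarrow> 'p) \<Rightarrow> 'p) \<Rightarrow> ('c \<Rightarrow> 'p) \<Rightarrow> bool" where
  "strong_Nash mech x \<longleftrightarrow> x \<in> L \<rightarrow>\<^sub>E M \<and>
     (\<forall>I x'. I \<subseteq> L \<longrightarrow> I \<noteq> {} \<longrightarrow> x' \<in> I \<rightarrow>\<^sub>E M \<longrightarrow>
       (\<exists>i\<in>I. d (loc i) (mech true_reports (override_on x x' I))
              \<ge> d (loc i) (mech true_reports x)))"

lemma GM_star_ex1:
  "\<exists>!A. A \<in> F \<and> (\<forall>B\<in>F. cost t x A \<le> cost t x B) \<and>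
     (\<forall>B\<in>F. cost t x B = cost t x A \<longrightarrow> (A, B) \<in> ord)"
proof -
  define S where "S = {A \<in> F. \<forall>B\<in>F. cost t x A \<le> cost t x B}"
  have "finite S" and "S \<subseteq> F"
    using finite_facilities by (auto simp: S_def)
  have "S \<noteq> {}"
    using ex_min_if_finite[of "cost t x ` F"] finite_facilities facilities_nonempty
    by (force simp: S_def not_less)
  have anti: "antisym ord"
    using facility_order by (simp add: order_on_defs)
  have "\<exists>A\<in>S. \<forall>B\<in>S. (A, B) \<in> ord"
    using \<open>finite S\<close> \<open>S \<noteq> {}\<close> \<open>S \<subseteq> F\<close>
  proof (induction rule: finite_ne_induct)
    case (singleton a)
    then show ?case
      using facility_order by (auto simp: order_on_defs refl_on_def)
  next
    case (insert a S)
    then obtain m where m: "m \<in> S" "\<forall>B\<in>S. (m, B) \<in> ord" by auto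
    have aa: "(a, a) \<in> ord" and tr: "trans ord" and tot: "(a, m) \<in> ord \<or> (m, a) \<in> ord"
      using facility_order insert m
      by (auto simp: order_on_defs refl_on_def total_on_def)
    from tot show ?case
    proof
      assume "(a, m) \<in> ord"
      then have "\<forall>B\<in>insert a S. (a, B) \<in> ord"
        using aa m transD[OF tr] by blast
      then show ?thesis by blast
    next
      assume "(m, a) \<in> ord"
      then show ?thesis using m by blast
    qed
  qed
  then obtain A where A: "A \<in> S" "\<forall>B\<in>S. (A, B) \<in> ord" by blast
  show ?thesis
  proof (rule ex1I[of _ A])
    show "A \<in> F \<and> (\<forall>B\<in>F. cost t x A \<le> cost t x B) \<and>
      (\<forall>B\<in>F. cost t x B = cost t x A \<longrightarrow> (A, B) \<in> ord)"
      using A by (auto simp: S_def)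
  next
    fix A'
    assume A': "A' \<in> F \<and> (\<forall>B\<in>F. cost t x A' \<le> cost t x B) \<and>
      (\<forall>B\<in>F. cost t x B = cost t x A' \<longrightarrow> (A', B) \<in> ord)"
    then have "A' \<in> S" "cost t x A = cost t x A'"
      using A by (auto simp: S_def intro: order_antisym)
    then have "(A, A') \<in> ord" "(A', A) \<in> ord"
      using A A' by (auto simp: S_def)
    then show "A' = A"
      using anti by (simp add: antisymD)
  qed
qed

end

end

theory Submission
  imports Defs
begin

text \<open>
  A strict majority of the clients, if it is strategic and all of it reports a facility \<open>A\<close>,
  forces the outcome \<open>A\<close> by the triangle inequality. Three strategic clients whose preferences
  on three facilities form a Condorcet cycle therefore have no strong Nash equilibrium: whatever
  the outcome, two of them prefer a common other facility. Such preferences do not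
  occur on a line, but they do on a circle: on the circle of length 9, the facilities are
  \<open>0, 3, 6\<close> and the clients \<open>1, 4, 7\<close>.
\<close>

context facility_instance
begin

lemma GM_star_in: "GM_star t x \<in> F"
  using theI'[OF GM_star_ex1[of t x]] by (simp add: GM_star_def)

lemma GM_star_eqI:
  assumes "A \<in> F" and "\<And>B. B \<in> F \<Longrightarrow> B \<noteq> A \<Longrightarrow> cost t x A < cost t x B"
  shows "GM_star t x = A"
proof -
  have "cost t x (GM_star t x) \<le> cost t x A"
    using theI'[OF GM_star_ex1[of t x]] assms(1) by (simp add: GM_star_def)
  then show ?thesis
    using assms(2)[OF GM_star_in] by force
qed

text \<open>Compare \<open>A\<close> with any other facility \<open>B\<close>: each member of
  \<open>I\<close> contributes \<open>d A B\<close> less to the cost of \<open>A\<close>, while by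
  the triangle inequality every other client contributes at most \<open>d A B\<close> more, wherever
  it reports.\<close>

lemma GM_star_majority:
  assumes "I \<subseteq> L" and majority: "card C < 2 * card I"
    and "A \<in> F" and t: "t \<in> T \<rightarrow> M" and x: "x \<in> L \<rightarrow> M"
  shows "GM_star t (override_on x (\<lambda>_. A) I) = A"
proof (rule GM_star_eqI)
  fix B
  assume "B \<in> F" "B \<noteq> A"
  have AB: "A \<in> M" "B \<in> M"
    using \<open>A \<in> F\<close> \<open>B \<in> F\<close> facilities_in_space by auto
  have fin: "finite T" "finite L" "finite I" "finite (L - I)"
    using finite_clients clients_partition \<open>I \<subseteq> L\<close> finite_subset by auto
  have "card C = card T + card L"
    using clients_partition fin by (simp add: card_Un_disjoint)
  moreover have "card L = card I + card (L - I)"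
    using fin \<open>I \<subseteq> L\<close> by (simp add: card_Diff_subset card_mono)
  ultimately have "real (card T) + real (card (L - I)) < real (card I)"
    using majority by linarith
  \<comment> \<open>Strict because distinct facilities are at positive distance; hence ties never
    arise.\<close>
  then have less: "(real (card T) + real (card (L - I))) * d A B < real (card I) * d A B"
    using AB \<open>B \<noteq> A\<close> by (intro mult_strict_right_mono) auto
  have tri: "d y A \<le> d y B + d A B" if "y \<in> M" for y
    using triangle[of y B A] commute[of A B] AB that by simp
  have split_L: "(\<Sum>i\<in>L. d (override_on x (\<lambda>_. A) I i) Q)
      = real (card I) * d A Q + (\<Sum>i\<in>L - I. d (x i) Q)" for Q
  proof -
    have "(\<Sum>i\<in>L. d (override_on x (\<lambda>_. A) I i) Q)
      = (\<Sum>i\<in>L - I. d (override_on x (\<lambda>_. A) I i) Q) + (\<Sum>i\<in>I. d (override_on x (\<lambda>_. A) I i) Q)"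
      using sum.subset_diff[OF \<open>I \<subseteq> L\<close>] fin by blast
    then show ?thesis
      by (simp add: override_on_def)
  qed
  have "(\<Sum>i\<in>T. d (t i) A) \<le> (\<Sum>i\<in>T. d (t i) B + d A B)"
    using t by (intro sum_mono tri) auto
  moreover have "(\<Sum>i\<in>L - I. d (x i) A) \<le> (\<Sum>i\<in>L - I. d (x i) B + d A B)"
    using x by (intro sum_mono tri) auto
  ultimately show "cost t (override_on x (\<lambda>_. A) I) A < cost t (override_on x (\<lambda>_. A) I) B"
    using less AB by (simp add: cost_def split_L sum.distrib algebra_simps)
qed (fact \<open>A \<in> F\<close>)

text \<open>Apply \<open>cycle\<close> to the current outcome: the coalition \<open>I\<close> that
  jointly reports \<open>A\<close> makes \<open>A\<close> win, to the benefit of all its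
  members.\<close>

lemma not_strong_Nash_if_majority_cycle:
  assumes cycle: "\<And>P. P \<in> F \<Longrightarrow> \<exists>A\<in>F. \<exists>I\<subseteq>L. card C < 2 * card I \<and>
    (\<forall>i\<in>I. d (loc i) A < d (loc i) P)"
  shows "\<not> strong_Nash GM_star x"
proof
  assume "strong_Nash GM_star x"
  then have x: "x \<in> L \<rightarrow>\<^sub>E M"
    and stable: "\<And>I x'. I \<subseteq> L \<Longrightarrow> I \<noteq> {} \<Longrightarrow> x' \<in> I \<rightarrow>\<^sub>E M \<Longrightarrow>
       \<exists>i\<in>I. d (loc i) (GM_star true_reports (override_on x x' I))
              \<ge> d (loc i) (GM_star true_reports x)"
    unfolding strong_Nash_def by blast+
  obtain A I where "A \<in> F" "I \<subseteq> L" and majority: "card C < 2 * card I"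
    and better: "\<And>i. i \<in> I \<Longrightarrow> d (loc i) A < d (loc i) (GM_star true_reports x)"
    using cycle[OF GM_star_in] by blast
  \<comment> \<open>Deviations are required to be extensional on \<open>I\<close>;
    \<open>override_on\<close> reads them only there.\<close>
  let ?x' = "restrict (\<lambda>_. A) I"
  have "I \<noteq> {}"
    using majority by auto
  moreover have "?x' \<in> I \<rightarrow>\<^sub>E M"
    using \<open>A \<in> F\<close> facilities_in_space by auto
  moreover have "override_on x ?x' I = override_on x (\<lambda>_. A) I"
    by (auto simp: override_on_def)
  moreover have "GM_star true_reports (override_on x (\<lambda>_. A) I) = A"
    using \<open>I \<subseteq> L\<close> majority \<open>A \<in> F\<close> x loc_in_space clients_partition
    by (intro GM_star_majority) (auto simp: true_reports_def)
  ultimately show False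
    using stable[OF \<open>I \<subseteq> L\<close>, of ?x'] better by force
qed

end

text \<open>
  The outer absolute value is idle on \<open>{0..<p}\<close>; \<open>Metric_space\<close> demands
  nonnegativity outside the carrier as well.
\<close>

definition circle_dist :: "real \<Rightarrow> real \<Rightarrow> real \<Rightarrow> real" where
  "circle_dist p x y = min \<bar>x - y\<bar> \<bar>p - \<bar>x - y\<bar>\<bar>"

text \<open>The interval is half-open because \<open>0\<close> and \<open>p\<close> would be
  distinct points at distance 0.\<close>

lemma Metric_space_circle: "Metric_space {0..<p} (circle_dist p)"
  by unfold_locales (auto simp: circle_dist_def min_def abs_if split: if_splits)

lemma linear_order_on_le: "linear_order_on A {(a, b). a \<in> A \<and> b \<in> A \<and> a \<le> (b :: 'a :: linorder)}"
  by (auto simp: order_on_defs refl_on_def total_on_def intro: transI antisymI)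

theorem theorem4p1:
  shows "\<exists>(M :: real set) d (C :: nat set) T L loc F ord.
    facility_instance M d C T L loc F ord \<and>
    \<not> (\<exists>x. facility_instance.strong_Nash M d T L loc
              (facility_instance.GM_star d T L F ord) x)"
proof -
  let ?d = "circle_dist 9" and ?C = "{0, 1, 2} :: nat set" and ?F = "{0, 3, 6} :: real set"
  \<comment> \<open>Going up around the circle, each client is at distance 1 from the facility just
    behind it, 2 from the one ahead and 4 from the third.\<close>
  let ?loc = "\<lambda>i. 3 * real i + 1"
  let ?ord = "{(a, b). a \<in> ?F \<and> b \<in> ?F \<and> a \<le> b}"
  interpret Metric_space "{0..<9}" ?d
    by (rule Metric_space_circle)
  interpret facility_instance "{0..<9}" ?d ?C "{}" ?C ?loc ?F ?ord
    by unfold_locales (use linear_order_on_le[of ?F] in auto)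
  have "\<exists>A\<in>?F. \<exists>I\<subseteq>?C. card ?C < 2 * card I \<and> (\<forall>i\<in>I. ?d (?loc i) A < ?d (?loc i) P)"
    if P: "P \<in> ?F" for P
  proof -
    consider "P = 0" | "P = 3" | "P = 6"
      using P by auto
    then show ?thesis
    \<comment> \<open>The witness \<open>A\<close> is the facility preceding \<open>P\<close> on the
      circle; \<open>I\<close> omits only the client just after \<open>P\<close>, for whom
      \<open>P\<close> is nearest.\<close>
    proof cases
      case 1
      then show ?thesis
        by (intro bexI[of _ 6] exI[of _ "{1, 2}"]) (auto simp: circle_dist_def)
    next
      case 2
      then show ?thesis
        by (intro bexI[of _ 0] exI[of _ "{0, 2}"]) (auto simp: circle_dist_def)
    next
      case 3
      then show ?thesis
        by (intro bexI[of _ 3] exI[of _ "{0, 1}"]) (auto simp: circle_dist_def)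
    qed
  qed
  then have "\<not> strong_Nash GM_star x" for x
    by (rule not_strong_Nash_if_majority_cycle)
  then show ?thesis
    using facility_instance_axioms by blast
qed

end
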